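(* Let $N\ge 2$ and let $\rho$ be the uniform probability measure on $[0,1]\subset\mathbb{R}$. Let $F=(F^1,\dots,F^N)$ be the tuple of maps associated to $\rho$ by the one-dimensional construction described in the context, and let $\rho_N:=F_{\#}\rho$, a probability measure on $\mathbb{R}^N$ all of whose marginals equal $\rho$. Then $\rho_N$ is optimal, i.e. $C_N(\rho_N)=E_N[\rho]$.
   Context: For a probability measure $\rho$ on $\mathbb{R}^d$, $\Pi(\rho)$ is the set of probability measures $\rho_N$ on $(\mathbb{R}^{d})^N$ with $(\pi_i)_{\#}\rho_N=\rho$ for $i=1,\dots,N$, where $\pi_i:(\mathbb{R}^{d})^N\to\mathbb{R}^d$ is the $i$th projection. For $\rho_N\in\Pi(\rho)$, $$C_N(\rho_N)=\int_{\mathbb{R}^{dN}}\sum_{i\ne j}\frac{1}{|x_i-x_j|}\,d\rho_N\in[0,\infty],\qquad E_N[\rho]=\inf_{\rho_N\in\Pi(\rho)}C_N(\rho_N),$$ with $1/0=+\infty$. Here $d=1$. One-dimensional construction. Let $\rho$ be an absolutely continuous probability measure on $\mathbb{R}$. Set $r^0=-\infty$, $r^i=\inf\{t:\rho((r^{i-1},t))\ge \frac1N\}$ for $i=1,\dots,N-1$, $r^N=+\infty$, and $I^i=[r^{i-1},r^i]$ (intersected with $\mathbb{R}$), so that $\rho(I^i)=\frac1N$. Superscripts of intervals are understood modulo $N$ with representatives in $\{1,\dots,N\}$. For $i,j\in\{1,\dots,N\}$, let $k\in\{1,\dots,N\}$ with $k\equiv i+j-1 \pmod N$; then $F^i$ maps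 $I^j$ to $I^{k}$ and is defined ($\rho$-almost everywhere) for $t\in I^j$ by $\rho((r^{k-1},F^i(t)))=\rho((r^{j-1},t))$. In particular $F^1$ is the identity, and each $F^i$ satisfies $(F^i)_{\#}\rho=\rho$. *)

theory Defs
  imports "HOL-Probability.Probability"
begin

(* A point of (R^d)^N is an extensional function on {1..N}, and a measure on
   (R^d)^N lives on the corresponding product sigma-algebra. *)

definition transport_plans :: "nat \<Rightarrow> 'a::euclidean_space measure \<Rightarrow> (nat \<Rightarrow> 'a) measure set" where
  "transport_plans N \<rho> =
     {M. prob_space M \<and> sets M = sets (Pi\<^sub>M {1..N} (\<lambda>_. borel)) \<and>
         (\<forall>i\<in>{1..N}. distr M borel (\<lambda>x. x i) = \<rho>)}"

(* In ennreal, 1 / 0 is infinite, as required on the diagonals x i = x j. *)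

definition coulomb_cost :: "nat \<Rightarrow> (nat \<Rightarrow> 'a::euclidean_space) measure \<Rightarrow> ennreal" where
  "coulomb_cost N M =
     (\<integral>\<^sup>+ x. (\<Sum>(i, j) \<in> {(i, j). i \<in> {1..N} \<and> j \<in> {1..N} \<and> i \<noteq> j}.
               1 / ennreal (norm (x i - x j))) \<partial>M)"

definition optimal_cost :: "nat \<Rightarrow> 'a::euclidean_space measure \<Rightarrow> ennreal" where
  "optimal_cost N \<rho> = (INF M \<in> transport_plans N \<rho>. coulomb_cost N M)"

fun cut_point :: "real measure \<Rightarrow> nat \<Rightarrow> nat \<Rightarrow> ereal" where
  "cut_point \<rho> N 0 = -\<infinity>"
| "cut_point \<rho> N (Suc i) =
     (if Suc i < N
      then Inf (ereal ` {t. measure \<rho> {s. cut_point \<rho> N i < ereal s \<and> s < t} \<ge> 1 / real N})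
      else \<infinity>)"

definition cell :: "real measure \<Rightarrow> nat \<Rightarrow> nat \<Rightarrow> real set" where
  "cell \<rho> N i = {t. cut_point \<rho> N (i - 1) \<le> ereal t \<and> ereal t \<le> cut_point \<rho> N i}"

(* The construction determines each F i only almost everywhere, so it is given as a
   predicate on tuples of Borel maps; the value of F at i outside {1..N} is irrelevant. *)

definition cyclic_maps :: "real measure \<Rightarrow> nat \<Rightarrow> (nat \<Rightarrow> real \<Rightarrow> real) \<Rightarrow> bool" where
  "cyclic_maps \<rho> N F \<longleftrightarrow>
     (\<forall>i\<in>{1..N}. F i \<in> borel_measurable borel \<and>
       (\<forall>j\<in>{1..N}. \<forall>k\<in>{1..N}. k mod N = (i + j - 1) mod N \<longrightarrow>
         (AE t in \<rho>. t \<in> cell \<rho> N j \<longrightarrow>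
            F i t \<in> cell \<rho> N k \<and>
            measure \<rho> {s. cut_point \<rho> N (k - 1) < ereal s \<and> s < F i t} =
            measure \<rho> {s. cut_point \<rho> N (j - 1) < ereal s \<and> s < t})))"

definition map_plan :: "nat \<Rightarrow> real measure \<Rightarrow> (nat \<Rightarrow> real \<Rightarrow> real) \<Rightarrow> (nat \<Rightarrow> real) measure" where
  "map_plan N \<rho> F = distr \<rho> (Pi\<^sub>M {1..N} (\<lambda>_. borel)) (\<lambda>t. \<lambda>i\<in>{1..N}. F i t)"

(* For the uniform measure on [0,1] the cuts are the points i/N and the predicate is
   satisfied by the translations by (i-1)/N modulo 1. *)

lemma measure_uniform01_Ioo:
  fixes a b :: real
  assumes "0 \<le> a" "a \<le> 1"
  shows "measure (uniform_measure lborel {0..1::real}) {s. a < s \<and> s < b} = max 0 (min b 1 - a)"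
proof -
  have "{0..1} \<inter> {s. a < s \<and> s < b} = (if b \<le> 1 then {a<..<b} else {a<..1})"
    using assms by auto
  then have "measure lborel ({0..1} \<inter> {s. a < s \<and> s < b}) = max 0 (min b 1 - a)"
    using assms by (cases "a \<le> b") (simp_all add: max_def min_def)
  moreover have "{s. a < s \<and> s < b} \<in> sets lborel" by measurable
  ultimately show ?thesis
    by (simp add: measure_uniform_measure)
qed

lemma measure_uniform01_less:
  fixes b :: real
  shows "measure (uniform_measure lborel {0..1::real}) {s. s < b} = max 0 (min b 1)"
proof -
  have "{0..1} \<inter> {s. s < b} = (if b \<le> 1 then {0..<b} else {0..1})"
    by auto
  then have "measure lborel ({0..1} \<inter> {s. s < b}) = max 0 (min b 1)"
    by (cases "0 \<le> b") (simp_all add: max_def min_def)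
  moreover have "{s. s < b} \<in> sets lborel" by measurable
  ultimately show ?thesis
    by (simp add: measure_uniform_measure)
qed

lemma cut_uniform01:
  assumes "1 \<le> i" "i < N"
  shows "cut_point (uniform_measure lborel {0..1}) N i = ereal (real i / real N)"
  using assms
proof (induction i)
  case 0
  then show ?case by simp
next
  case (Suc i)
  let ?c = "real (Suc i) / real N"
  have c: "0 < ?c" "?c < 1" using Suc.prems by auto
  have "{t. measure (uniform_measure lborel {0..1})
             {s. cut_point (uniform_measure lborel {0..1}) N i < ereal s \<and> s < t} \<ge> 1 / real N}
        = {?c..}"
  proof (cases "i = 0")
    case True
    have "0 < 1 / real N" "1 / real N < 1" using c True by simp_all
    then have "(1 / real N \<le> max 0 (min t 1)) = (1 / real N \<le> t)" for t
      by linarith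
    with True show ?thesis by (auto simp: measure_uniform01_less simp del: measure_uniform_measure)
  next
    case False
    then have IH: "cut_point (uniform_measure lborel {0..1}) N i = ereal (real i / real N)"
      using Suc by simp
    have "?c = real i / real N + 1 / real N" by (simp add: add_divide_distrib)
    moreover have "0 < 1 / real N" using Suc.prems by simp
    ultimately have "(1 / real N \<le> max 0 (min t 1 - real i / real N)) = (?c \<le> t)" for t
      using c by linarith
    moreover have "0 \<le> real i / real N" "real i / real N \<le> 1"
      using Suc.prems by auto
    ultimately show ?thesis
      by (auto simp: IH measure_uniform01_Ioo simp del: of_nat_Suc measure_uniform_measure)
  qed
  moreover have "Inf (ereal ` {?c..}) = ereal ?c"
    by (intro antisym Inf_lower Inf_greatest) auto
  ultimately show ?case using Suc.prems by simp
qed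

lemma measure_cut_uniform01:
  fixes t :: real
  assumes "1 \<le> j" "j \<le> N" "(real j - 1) / real N < t" "t < real j / real N"
  shows "measure (uniform_measure lborel {0..1})
           {s. cut_point (uniform_measure lborel {0..1}) N (j - 1) < ereal s \<and> s < t}
         = t - (real j - 1) / real N"
proof -
  have "real j / real N \<le> 1" using assms by simp
  with assms have t: "t < 1" by linarith
  show ?thesis
  proof (cases "j = 1")
    case True
    then show ?thesis using assms t by (simp add: measure_uniform01_less del: measure_uniform_measure)
  next
    case False
    then have "cut_point (uniform_measure lborel {0..1}) N (j - 1) = ereal ((real j - 1) / real N)"
      using assms cut_uniform01[of "j - 1" N] by (simp add: of_nat_diff)
    moreover have "0 \<le> (real j - 1) / real N" "(real j - 1) / real N \<le> 1"
      using assms t by auto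
    ultimately show ?thesis using assms t by (simp add: measure_uniform01_Ioo del: measure_uniform_measure)
  qed
qed

lemma cell_uniform01:
  fixes t :: real
  assumes "1 \<le> j" "j \<le> N"
  shows "t \<in> cell (uniform_measure lborel {0..1}) N j \<longleftrightarrow>
           (j = 1 \<or> (real j - 1) / real N \<le> t) \<and> (j = N \<or> t \<le> real j / real N)"
proof -
  have "cut_point (uniform_measure lborel {0..1}) N (j - 1) =
          (if j = 1 then -\<infinity> else ereal ((real j - 1) / real N))"
    using assms cut_uniform01[of "j - 1" N] by (auto simp: of_nat_diff)
  moreover have "cut_point (uniform_measure lborel {0..1}) N j =
          (if j = N then \<infinity> else ereal (real j / real N))"
    using assms cut_uniform01[of j N] by (cases j) auto
  ultimately show ?thesis by (auto simp: cell_def)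
qed

lemma cyclic_maps_uniform01:
  assumes "2 \<le> N"
  shows "cyclic_maps (uniform_measure lborel {0..1}) N (\<lambda>i t. frac (t + (real i - 1) / real N))"
  unfolding cyclic_maps_def
proof (intro ballI impI conjI)
  fix i assume "i \<in> {1..N}"
  show "(\<lambda>t. frac (t + (real i - 1) / real N)) \<in> borel_measurable borel"
    unfolding frac_def by measurable
next
  fix i j k assume ijk: "i \<in> {1..N}" "j \<in> {1..N}" "k \<in> {1..N}" "k mod N = (i + j - 1) mod N"
  let ?U = "uniform_measure lborel {0..1::real}"
  let ?F = "\<lambda>t. frac (t + (real i - 1) / real N)"
  have N: "real N > 0" using assms by simp
  have k: "k = i + j - 1 \<or> k + N = i + j - 1"
  proof -
    have "int N dvd int k - int (i + j - 1)"
      using ijk(4) by (metis mod_eq_dvd_iff zmod_int)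
    then obtain q where q: "int k - int (i + j - 1) = int N * q" by blast
    have "int N * q < int N * 1" "int N * (-2) < int N * q"
      using q[symmetric] ijk assms by auto
    then have "q < 1" "-2 < q"
      using mult_less_cancel_left_pos[of "int N" "-2" q] assms
      by (simp_all add: mult_less_cancel_left)
    then have "q = 0 \<or> q = -1" by auto
    with q show ?thesis by auto
  qed
  have F: "?F t = t + (real k - real j) / real N"
    if t: "(real j - 1) / real N < t" "t < real j / real N" for t
  proof -
    obtain m :: int where m: "real i - 1 = real k - real j + real N * of_int m"
    proof -
      have "real i - 1 = real k - real j + real N * of_int 0 \<or>
            real i - 1 = real k - real j + real N * of_int 1"
        using k ijk by auto
      then show ?thesis using that by blast
    qed
    have "t + (real i - 1) / real N = (t + (real k - real j) / real N) + of_int m"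
      using N by (simp add: m field_simps)
    moreover have "0 \<le> t + (real k - real j) / real N" "t + (real k - real j) / real N < 1"
    proof -
      have "0 \<le> (real k - 1) / real N" "real k / real N \<le> 1" using ijk by auto
      then show "0 \<le> t + (real k - real j) / real N" "t + (real k - real j) / real N < 1"
        using t by (simp_all add: diff_divide_distrib)
    qed
    ultimately show ?thesis by (simp add: frac_unique_iff)
  qed
  have "AE t in lborel. t \<in> {0..1} \<longrightarrow>
      t \<noteq> (real j - 1) / real N \<and> t \<noteq> real j / real N \<and> 0 < t \<and> t < 1"
    using AE_lborel_singleton[of "(real j - 1) / real N"] AE_lborel_singleton[of "real j / real N"]
      AE_lborel_singleton[of "0::real"] AE_lborel_singleton[of "1::real"]
    by eventually_elim auto
  then have "AE t in ?U. t \<noteq> (real j - 1) / real N \<and> t \<noteq> real j / real N \<and> 0 < t \<and> t < 1"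
    by (subst AE_uniform_measure) auto
  then show "AE t in ?U. t \<in> cell ?U N j \<longrightarrow> ?F t \<in> cell ?U N k \<and>
      measure ?U {s. cut_point ?U N (k - 1) < ereal s \<and> s < ?F t} =
      measure ?U {s. cut_point ?U N (j - 1) < ereal s \<and> s < t}"
  proof (rule eventually_mono, intro impI)
    fix t assume t: "t \<noteq> (real j - 1) / real N \<and> t \<noteq> real j / real N \<and> 0 < t \<and> t < 1"
      and "t \<in> cell ?U N j"
    then have tj: "(real j - 1) / real N < t" "t < real j / real N"
      using ijk N by (auto simp: cell_uniform01)
    let ?u = "t + (real k - real j) / real N"
    have uk: "(real k - 1) / real N < ?u" "?u < real k / real N"
      using tj by (simp_all add: diff_divide_distrib)
    have "?u - (real k - 1) / real N = t - (real j - 1) / real N"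
      by (simp add: diff_divide_distrib)
    then have "measure ?U {s. cut_point ?U N (k - 1) < ereal s \<and> s < ?u} =
        measure ?U {s. cut_point ?U N (j - 1) < ereal s \<and> s < t}"
      using measure_cut_uniform01[of k N ?u] measure_cut_uniform01[of j N t] ijk uk tj by auto
    moreover have "?u \<in> cell ?U N k"
      using ijk uk by (simp add: cell_uniform01)
    ultimately show "?F t \<in> cell ?U N k \<and>
      measure ?U {s. cut_point ?U N (k - 1) < ereal s \<and> s < ?F t} =
      measure ?U {s. cut_point ?U N (j - 1) < ereal s \<and> s < t}"
      unfolding F[OF tj] by blast
  qed
qed

end

theory Submission imports Defs begin

text \<open>
  The plan has constant cost, because it lives on tuples that are equally spaced with step
  \<open>1 / N\<close>. For the lower bound, sort \<open>x\<close> as \<open>y\<^sub>1 \<le> \<dots> \<le> y\<^sub>N\<close> and replace \<open>1 / d\<close>, for the gap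
  \<open>d = y\<^sub>p\<^sub>+\<^sub>k - y\<^sub>p\<close>, by its tangent line at \<open>k / N\<close>. What remains is to bound \<open>\<Sum>\<^sub>p (y\<^sub>p\<^sub>+\<^sub>k - y\<^sub>p)\<close>
  from above by a sum of functions of the single coordinates: the top \<open>N - k\<close> points \<open>u\<close> satisfy
  \<open>u \<le> k / N + (u - k / N)\<^sub>+\<close> and the bottom ones \<open>u \<ge> 1 - k / N - (1 - k / N - u)\<^sub>+\<close>, and the
  positive parts may be summed over all coordinates. The expectation of the result depends only on
  the marginals, and for equally spaced points every inequality is an equality.
\<close>

section \<open>Sorting the coordinates and grouping pairs by rank difference\<close>

lemma ex_sorting_bij:
  fixes x :: "nat \<Rightarrow> 'a::linorder"
  obtains \<sigma> where "bij_betw \<sigma> {1..N} {1..N}"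
    "\<And>p q. 1 \<le> p \<Longrightarrow> p \<le> q \<Longrightarrow> q \<le> N \<Longrightarrow> x (\<sigma> p) \<le> x (\<sigma> q)"
proof -
  define xs where "xs = sort_key x [1..<N + 1]"
  have len: "length xs = N" and "distinct xs" and set: "set xs = {1..N}"
    by (auto simp: xs_def)
  have "bij_betw (\<lambda>i. i - 1) {1..N} {..<N}"
    by (rule bij_betw_byWitness[where f' = Suc]) auto
  moreover have "bij_betw ((!) xs) {..<N} {1..N}"
    using \<open>distinct xs\<close> len set by (intro bij_betw_nth) auto
  ultimately have "bij_betw ((!) xs \<circ> (\<lambda>i. i - 1)) {1..N} {1..N}"
    by (rule bij_betw_trans)
  moreover have "x (((!) xs \<circ> (\<lambda>i. i - 1)) p) \<le> x (((!) xs \<circ> (\<lambda>i. i - 1)) q)"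
    if "1 \<le> p" "p \<le> q" "q \<le> N" for p q
  proof -
    have "sorted (map x xs)" by (simp add: xs_def)
    then have "map x xs ! (p - 1) \<le> map x xs ! (q - 1)"
      using that len by (intro sorted_nth_mono) auto
    then show ?thesis using that len by simp
  qed
  ultimately show ?thesis by (rule that)
qed

text \<open>The triangles \<open>p < q\<close> and \<open>q < p\<close> contribute equally by
  symmetry. The first is parametrised by \<open>k = q - p\<close>, because the tangent point used
  later depends on the rank difference alone.\<close>

lemma sum_offdiagonal_by_gap:
  fixes f :: "nat \<Rightarrow> nat \<Rightarrow> 'a::comm_semiring_1"
  assumes sym: "\<And>p q. f p q = f q p"
  shows "(\<Sum>(p, q) \<in> {(p, q). p \<in> {1..N} \<and> q \<in> {1..N} \<and> p \<noteq> q}. f p q) =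
    2 * (\<Sum>k\<in>{1..<N}. \<Sum>p\<in>{1..N - k}. f p (p + k))"
proof -
  let ?L = "{(p, q). p \<in> {1..N} \<and> q \<in> {1..N} \<and> p < q}"
  let ?U = "{(p, q). p \<in> {1..N} \<and> q \<in> {1..N} \<and> q < p}"
  have "finite ?L" "finite ?U"
    by (rule finite_subset[of _ "{1..N} \<times> {1..N}"]; auto)+
  moreover have "?L \<inter> ?U = {}" by auto
  moreover have "{(p, q). p \<in> {1..N} \<and> q \<in> {1..N} \<and> p \<noteq> q} = ?L \<union> ?U" by auto
  ultimately have "(\<Sum>(p, q) \<in> {(p, q). p \<in> {1..N} \<and> q \<in> {1..N} \<and> p \<noteq> q}. f p q) =
      (\<Sum>(p, q)\<in>?L. f p q) + (\<Sum>(p, q)\<in>?U. f p q)"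
    by (simp only: sum.union_disjoint)
  also have "(\<Sum>(p, q)\<in>?U. f p q) = (\<Sum>(p, q)\<in>?L. f p q)"
    by (rule sum.reindex_bij_witness[where i = prod.swap and j = prod.swap]) (auto simp: sym)
  also have "(\<Sum>(p, q)\<in>?L. f p q) = (\<Sum>k\<in>{1..<N}. \<Sum>p\<in>{1..N - k}. f p (p + k))"
    unfolding sum.Sigma[OF finite_atLeastLessThan ballI[OF finite_atLeastAtMost]]
    by (rule sum.reindex_bij_witness[where i = "\<lambda>(k, p). (p, p + k)" and j = "\<lambda>(p, q). (q - p, p)"])
      auto
  finally show ?thesis by (simp only: mult_2)
qed

text \<open>Relabelling the coordinates by \<open>\<sigma>\<close> permutes the ordered pairs, so
  the sum is unchanged; monotonicity then removes the absolute values.\<close>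

lemma coulomb_sum_sorted:
  fixes x :: "nat \<Rightarrow> real"
  assumes \<sigma>: "bij_betw \<sigma> {1..N} {1..N}"
    and mono: "\<And>p q. 1 \<le> p \<Longrightarrow> p \<le> q \<Longrightarrow> q \<le> N \<Longrightarrow> x (\<sigma> p) \<le> x (\<sigma> q)"
  shows "(\<Sum>(i, j) \<in> {(i, j). i \<in> {1..N} \<and> j \<in> {1..N} \<and> i \<noteq> j}.
      1 / ennreal (norm (x i - x j))) =
    2 * (\<Sum>k\<in>{1..<N}. \<Sum>p\<in>{1..N - k}. 1 / ennreal (x (\<sigma> (p + k)) - x (\<sigma> p)))"
    (is "sum _ ?O = _")
proof -
  have "bij_betw (map_prod \<sigma> \<sigma>) ?O ?O"
  proof (rule bij_betwI')
    fix a b assume "a \<in> ?O" "b \<in> ?O"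
    then show "(map_prod \<sigma> \<sigma> a = map_prod \<sigma> \<sigma> b) = (a = b)"
      using bij_betw_imp_inj_on[OF \<sigma>] by (auto simp: inj_on_eq_iff)
  next
    fix a assume "a \<in> ?O"
    then show "map_prod \<sigma> \<sigma> a \<in> ?O"
      using bij_betw_imp_inj_on[OF \<sigma>] bij_betwE[OF \<sigma>] by (auto simp: inj_on_eq_iff)
  next
    fix b assume "b \<in> ?O"
    moreover obtain i j where "b = (i, j)" by fastforce
    moreover have "i \<in> \<sigma> ` {1..N}" "j \<in> \<sigma> ` {1..N}"
      using calculation bij_betw_imp_surj_on[OF \<sigma>] by auto
    then obtain p q where "p \<in> {1..N}" "q \<in> {1..N}" "i = \<sigma> p" "j = \<sigma> q" by blast
    ultimately show "\<exists>a\<in>?O. b = map_prod \<sigma> \<sigma> a"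
      by (intro bexI[of _ "(p, q)"]) auto
  qed
  then have "(\<Sum>(i, j) \<in> ?O. 1 / ennreal (norm (x i - x j))) =
      (\<Sum>(p, q) \<in> ?O. 1 / ennreal (norm (x (\<sigma> p) - x (\<sigma> q))))"
    by (subst sum.reindex_bij_betw[symmetric]) (auto simp: case_prod_beta)
  also have "\<dots> = 2 * (\<Sum>k\<in>{1..<N}. \<Sum>p\<in>{1..N - k}. 1 / ennreal (norm (x (\<sigma> p) - x (\<sigma> (p + k)))))"
    by (rule sum_offdiagonal_by_gap) (simp only: norm_minus_commute)
  also have "\<dots> = 2 * (\<Sum>k\<in>{1..<N}. \<Sum>p\<in>{1..N - k}. 1 / ennreal (x (\<sigma> (p + k)) - x (\<sigma> p)))"
  proof (intro arg_cong[where f = "(*) 2"] sum.cong refl)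
    fix k p assume "k \<in> {1..<N}" "p \<in> {1..N - k}"
    then have "x (\<sigma> p) \<le> x (\<sigma> (p + k))" by (intro mono) auto
    then show "1 / ennreal (norm (x (\<sigma> p) - x (\<sigma> (p + k)))) = 1 / ennreal (x (\<sigma> (p + k)) - x (\<sigma> p))"
      by simp
  qed
  finally show ?thesis .
qed

section \<open>A pointwise lower bound by functions of single coordinates\<close>

lemma inverse_tangent_le:
  fixes b d :: real
  assumes "0 < b" "0 \<le> d"
  shows "ennreal (2 / b - d / b\<^sup>2) \<le> 1 / ennreal d"
proof (cases "d = 0")
  case False
  \<comment> \<open>The reciprocal exceeds its tangent line at \<open>b\<close> by exactly this
    square term. At \<open>d = 0\<close> the right-hand side of the claim is infinite.\<close>
  have "0 \<le> (d - b)\<^sup>2 / (d * b\<^sup>2)" using assms by simp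
  also have "\<dots> = 1 / d - (2 / b - d / b\<^sup>2)"
    using assms False by (simp add: field_simps power2_eq_square)
  finally show ?thesis
    using assms False by (simp add: divide_ennreal[of 1 d, simplified] ennreal_leI)
qed simp

text \<open>The potential by which a single coordinate enters the upper bound for the sum of the
  gaps of rank difference \<open>k\<close>. Both positive parts are kept together because both are
  summed over all coordinates.\<close>

definition hinge :: "nat \<Rightarrow> nat \<Rightarrow> real \<Rightarrow> real" where
  "hinge N k t = max 0 (t - real k / real N) + max 0 (1 - real k / real N - t)"

lemma gap_sum_le_hinge:
  fixes y :: "nat \<Rightarrow> real"
  assumes "k < N"
  shows "(\<Sum>p\<in>{1..N - k}. y (p + k) - y p) \<le>
    (real N - real k) * (2 * real k / real N - 1) + (\<Sum>i\<in>{1..N}. hinge N k (y i))"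
proof -
  let ?c = "real k / real N"
  \<comment> \<open>The constant is \<open>?c - (1 - ?c)\<close>: the upper point is compared with
    \<open>?c\<close> and the lower one with \<open>1 - ?c\<close>.\<close>
  have "(\<Sum>p\<in>{1..N - k}. y (p + k) - y p) \<le>
     (\<Sum>p\<in>{1..N - k}. (2 * ?c - 1) + max 0 (y (p + k) - ?c) + max 0 (1 - ?c - y p))"
    by (intro sum_mono) linarith
  also have "\<dots> = (real N - real k) * (2 * ?c - 1)
      + (\<Sum>p\<in>{1..N - k}. max 0 (y (p + k) - ?c)) + (\<Sum>p\<in>{1..N - k}. max 0 (1 - ?c - y p))"
    using assms by (simp add: sum.distrib of_nat_diff del: max_0_1)
  also have "(\<Sum>p\<in>{1..N - k}. max 0 (y (p + k) - ?c)) = (\<Sum>i\<in>{1 + k..N}. max 0 (y i - ?c))"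
    using assms by (intro sum.reindex_bij_witness[where i = "\<lambda>i. i - k" and j = "\<lambda>p. p + k"]) auto
  \<comment> \<open>Positive parts are nonnegative, so enlarging the index range can only increase
    the sum. The result is symmetric in the coordinates, which lets the sorting be undone
    later.\<close>
  also have "\<dots> \<le> (\<Sum>i\<in>{1..N}. max 0 (y i - ?c))"
    by (intro sum_mono2) auto
  also have "(\<Sum>p\<in>{1..N - k}. max 0 (1 - ?c - y p)) \<le> (\<Sum>i\<in>{1..N}. max 0 (1 - ?c - y i))"
    by (intro sum_mono2) auto
  finally show ?thesis by (simp add: hinge_def sum.distrib)
qed

text \<open>With tangent point \<open>k / N\<close>, each of the \<open>N - k\<close> pairs of rank
  difference \<open>k\<close> contributes the constant \<open>2 * N / k\<close> minus
  \<open>(N / k)^2\<close> times its gap. The gap sums enter with a negative coefficient, so upper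
  bounds for them give a lower bound for the cost.\<close>

lemma coulomb_sum_ge_separable:
  fixes x :: "nat \<Rightarrow> real"
  shows "2 * ennreal (\<Sum>k\<in>{1..<N}. (real N - real k) * (2 * real N / real k) - (real N / real k)\<^sup>2 *
        ((real N - real k) * (2 * real k / real N - 1) + (\<Sum>i\<in>{1..N}. hinge N k (x i)))) \<le>
    (\<Sum>(i, j) \<in> {(i, j). i \<in> {1..N} \<and> j \<in> {1..N} \<and> i \<noteq> j}. 1 / ennreal (norm (x i - x j)))"
proof -
  obtain \<sigma> where \<sigma>: "bij_betw \<sigma> {1..N} {1..N}"
    and mono: "\<And>p q. 1 \<le> p \<Longrightarrow> p \<le> q \<Longrightarrow> q \<le> N \<Longrightarrow> x (\<sigma> p) \<le> x (\<sigma> q)"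
    using ex_sorting_bij[where x = x and N = N] by metis
  let ?y = "\<lambda>p. x (\<sigma> p)"
  let ?l = "\<lambda>k p. 2 / (real k / real N) - (?y (p + k) - ?y p) / (real k / real N)\<^sup>2"
  \<comment> \<open>This symmetry removes the sorting, which depends on \<open>x\<close>, from the
    final bound.\<close>
  have hinge: "(\<Sum>i\<in>{1..N}. hinge N k (x i)) = (\<Sum>i\<in>{1..N}. hinge N k (?y i))" for k
    by (rule sum.reindex_bij_betw[OF \<sigma>, symmetric])
  have "(real N - real k) * (2 * real N / real k) - (real N / real k)\<^sup>2 *
        ((real N - real k) * (2 * real k / real N - 1) + (\<Sum>i\<in>{1..N}. hinge N k (x i)))
      \<le> (\<Sum>p\<in>{1..N - k}. ?l k p)" if "k \<in> {1..<N}" for k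
  proof -
    have "(\<Sum>p\<in>{1..N - k}. ?l k p) =
        (\<Sum>p\<in>{1..N - k}. 2 * real N / real k - (real N / real k)\<^sup>2 * (?y (p + k) - ?y p))"
      by (simp add: power_divide mult.commute)
    also have "\<dots> = (\<Sum>p\<in>{1..N - k}. 2 * real N / real k) -
        (\<Sum>p\<in>{1..N - k}. (real N / real k)\<^sup>2 * (?y (p + k) - ?y p))"
      by (rule sum_subtractf)
    also have "\<dots> = (real N - real k) * (2 * real N / real k)
        - (real N / real k)\<^sup>2 * (\<Sum>p\<in>{1..N - k}. ?y (p + k) - ?y p)"
      using that unfolding sum_distrib_left[symmetric] by (simp add: of_nat_diff)
    finally have "(\<Sum>p\<in>{1..N - k}. ?l k p) = (real N - real k) * (2 * real N / real k)
        - (real N / real k)\<^sup>2 * (\<Sum>p\<in>{1..N - k}. ?y (p + k) - ?y p)" .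
    moreover have "(real N / real k)\<^sup>2 * (\<Sum>p\<in>{1..N - k}. ?y (p + k) - ?y p) \<le> (real N / real k)\<^sup>2 *
        ((real N - real k) * (2 * real k / real N - 1) + (\<Sum>i\<in>{1..N}. hinge N k (x i)))"
      unfolding hinge using that by (intro mult_left_mono gap_sum_le_hinge) auto
    ultimately show ?thesis by linarith
  qed
  then have "2 * ennreal (\<Sum>k\<in>{1..<N}. (real N - real k) * (2 * real N / real k) - (real N / real k)\<^sup>2 *
        ((real N - real k) * (2 * real k / real N - 1) + (\<Sum>i\<in>{1..N}. hinge N k (x i)))) \<le>
      2 * ennreal (\<Sum>k\<in>{1..<N}. \<Sum>p\<in>{1..N - k}. ?l k p)"
    by (intro mult_left_mono ennreal_leI sum_mono) auto
  also have "\<dots> \<le> 2 * (\<Sum>k\<in>{1..<N}. \<Sum>p\<in>{1..N - k}. ennreal (?l k p))"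
  proof -
    \<comment> \<open>Tangent lines can be negative and \<open>ennreal\<close> truncates at 0, so
      only this inequality is available; its direction is the one required.\<close>
    have sub: "ennreal (sum f A) \<le> (\<Sum>a\<in>A. ennreal (f a))" for f :: "nat \<Rightarrow> real" and A
    proof -
      have "ennreal (sum f A) \<le> ennreal (\<Sum>a\<in>A. max 0 (f a))"
        by (intro ennreal_leI sum_mono) simp
      also have "\<dots> = (\<Sum>a\<in>A. ennreal (f a))"
        by (subst sum_ennreal[symmetric]) simp_all
      finally show ?thesis .
    qed
    show ?thesis
      by (intro mult_left_mono order_trans[OF sub] sum_mono sub) auto
  qed
  also have "\<dots> \<le> 2 * (\<Sum>k\<in>{1..<N}. \<Sum>p\<in>{1..N - k}. 1 / ennreal (?y (p + k) - ?y p))"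
    using mono by (intro mult_left_mono sum_mono inverse_tangent_le) auto
  finally show ?thesis
    by (simp only: coulomb_sum_sorted[where x = x, OF \<sigma> mono])
qed

section \<open>Integrating the bound against uniform marginals\<close>

lemma uniform01_has_integral:
  fixes f :: "real \<Rightarrow> real"
  assumes [measurable]: "f \<in> borel_measurable borel"
    and "has_bochner_integral lborel (\<lambda>t. f t * indicator {0..1} t) v"
  shows "has_bochner_integral (uniform_measure lborel {0..1}) f v"
proof -
  have "uniform_measure lborel {0..1::real} = density lborel (\<lambda>t. ennreal (indicator {0..1} t))"
    unfolding uniform_measure_def by (intro density_cong) (auto split: split_indicator)
  with assms(2) show ?thesis
    by (auto simp: has_bochner_integral_iff integrable_density integral_density mult.commute)
qed

text \<open>On \<open>[0,1]\<close> the two positive parts are mirror images under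
  \<open>t \<mapsto> 1 - t\<close>. Each bounds a right triangle with both legs
  \<open>1 - k / N\<close>, hence of area half the square.\<close>

lemma hinge_integral:
  assumes "k \<le> N" "0 < N"
  shows "has_bochner_integral (uniform_measure lborel {0..1}) (hinge N k) ((1 - real k / real N)\<^sup>2)"
proof -
  define c where "c = real k / real N"
  have c: "0 \<le> c" "c \<le> 1" using assms by (auto simp: c_def)
  have "has_bochner_integral lborel (\<lambda>t. (t - c) * indicator {c..1} t) ((1 - c)\<^sup>2 / 2 - (c - c)\<^sup>2 / 2)"
    using c by (intro has_bochner_integral_FTC_Icc_real[where F = "\<lambda>t. (t - c)\<^sup>2 / 2"])
      (auto intro!: derivative_eq_intros)
  moreover have "has_bochner_integral lborel (\<lambda>t. (1 - c - t) * indicator {0..1 - c} t)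
      (- ((1 - c - (1 - c))\<^sup>2 / 2) - - ((1 - c - 0)\<^sup>2 / 2))"
    using c by (intro has_bochner_integral_FTC_Icc_real[where F = "\<lambda>t. - ((1 - c - t)\<^sup>2 / 2)"])
      (auto intro!: derivative_eq_intros simp: field_simps)
  ultimately have "has_bochner_integral lborel
      (\<lambda>t. (t - c) * indicator {c..1} t + (1 - c - t) * indicator {0..1 - c} t) ((1 - c)\<^sup>2)"
    using has_bochner_integral_add by fastforce
  moreover have "(t - c) * indicator {c..1} t + (1 - c - t) * indicator {0..1 - c} t =
      hinge N k t * indicator {0..1} t" for t
    using c by (auto simp: hinge_def c_def[symmetric] split: split_indicator)
  moreover have "hinge N k \<in> borel_measurable borel"
    unfolding hinge_def[abs_def] by measurable
  ultimately show ?thesis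
    by (intro uniform01_has_integral) (simp_all add: c_def)
qed

lemma coulomb_cost_ge_uniform01:
  assumes "M \<in> transport_plans N (uniform_measure lborel {0..1::real})"
  shows "2 * ennreal (\<Sum>k\<in>{1..<N}. (real N - real k) * (real N / real k)) \<le> coulomb_cost N M"
proof -
  let ?U = "uniform_measure lborel {0..1::real}"
  interpret prob_space M using assms by (simp add: transport_plans_def)
  have sets: "sets M = sets (Pi\<^sub>M {1..N} (\<lambda>_. borel))"
    and marginal: "\<And>i. i \<in> {1..N} \<Longrightarrow> distr M borel (\<lambda>x. x i) = ?U"
    using assms by (auto simp: transport_plans_def)
  let ?g = "\<lambda>x :: nat \<Rightarrow> real. \<Sum>k\<in>{1..<N}. (real N - real k) * (2 * real N / real k) - (real N / real k)\<^sup>2 *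
        ((real N - real k) * (2 * real k / real N - 1) + (\<Sum>i\<in>{1..N}. hinge N k (x i)))"
  have "has_bochner_integral M (\<lambda>x. hinge N k (x i)) ((1 - real k / real N)\<^sup>2)"
    if "k \<in> {1..<N}" "i \<in> {1..N}" for i k
  proof -
    have [measurable]: "(\<lambda>x. x i) \<in> borel_measurable M"
      unfolding measurable_cong_sets[OF sets refl]
      using that(2) by (rule measurable_component_singleton)
    have "hinge N k \<in> borel_measurable borel"
      unfolding hinge_def[abs_def] by measurable
    with hinge_integral[of k N] that show ?thesis
      by (simp add: has_bochner_integral_iff marginal[OF that(2), symmetric]
          integrable_distr_eq integral_distr)
  qed
  then have "has_bochner_integral M ?g (\<Sum>k\<in>{1..<N}. (real N - real k) * (2 * real N / real k) -
      (real N / real k)\<^sup>2 * ((real N - real k) * (2 * real k / real N - 1) +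
        (\<Sum>i\<in>{1..N}. (1 - real k / real N)\<^sup>2)))"
    by (intro has_bochner_integral_sum has_bochner_integral_diff has_bochner_integral_mult_right
        has_bochner_integral_add) (auto simp: has_bochner_integral_iff prob_space)
  \<comment> \<open>The hinge expectations add up to \<open>(N - k)^2 / N\<close>, so the bracket
    collapses to \<open>(N - k) * k / N\<close>, the gap sum of points with spacing
    \<open>1 / N\<close>.\<close>
  moreover have "(real N - real k) * (2 * real N / real k) - (real N / real k)\<^sup>2 *
      ((real N - real k) * (2 * real k / real N - 1) + (\<Sum>i\<in>{1..N}. (1 - real k / real N)\<^sup>2)) =
      (real N - real k) * (real N / real k)" if "k \<in> {1..<N}" for k
    using that by (simp add: field_simps power2_eq_square)
  ultimately have g: "integrable M ?g"
      "integral\<^sup>L M ?g = (\<Sum>k\<in>{1..<N}. (real N - real k) * (real N / real k))"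
    by (simp_all add: has_bochner_integral_iff)
  \<comment> \<open>The nonnegative integral of \<open>ennreal (?g x)\<close> sees only the positive
    part of \<open>?g\<close>, which can only raise the value.\<close>
  have "ennreal (integral\<^sup>L M ?g) \<le> ennreal (\<integral>x. max 0 (?g x) \<partial>M)"
    using g(1) by (intro ennreal_leI integral_mono) auto
  also have "\<dots> = (\<integral>\<^sup>+x. ennreal (?g x) \<partial>M)"
    using g(1) by (subst nn_integral_eq_integral[symmetric]) auto
  finally have "2 * ennreal (integral\<^sup>L M ?g) \<le> (\<integral>\<^sup>+x. 2 * ennreal (?g x) \<partial>M)"
    using g(1) by (subst nn_integral_cmult) (auto intro!: mult_left_mono)
  also have "\<dots> \<le> coulomb_cost N M"
    unfolding coulomb_cost_def by (intro nn_integral_mono coulomb_sum_ge_separable)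
  finally show ?thesis by (simp only: g(2))
qed

section \<open>Explicit form of the cyclic maps\<close>

lemma AE_uniform01_cell:
  assumes "0 < N"
  shows "AE t in uniform_measure lborel {0..1}.
    \<exists>j\<in>{1..N}. (real j - 1) / real N < t \<and> t < real j / real N"
proof (rule AE_uniform_measureI)
  \<comment> \<open>Starting at \<open>j = 0\<close> excludes both endpoints 0 and 1 along with the
    interior cuts, so the ceiling below lands in \<open>{1..N}\<close>.\<close>
  have "AE t in lborel. \<forall>j\<in>{0..N}. t \<noteq> real j / real N"
    by (intro AE_finite_allI AE_lborel_singleton) auto
  then show "AE t in lborel. t \<in> {0..1} \<longrightarrow>
      (\<exists>j\<in>{1..N}. (real j - 1) / real N < t \<and> t < real j / real N)"
  proof (rule eventually_mono, intro impI)
    fix t :: real assume t: "\<forall>j\<in>{0..N}. t \<noteq> real j / real N" "t \<in> {0..1}"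
    define j where "j = nat \<lceil>t * real N\<rceil>"
    have "0 < t" "t < 1" using t assms bspec[OF t(1), of 0] bspec[OF t(1), of N] by auto
    then have j: "real j - 1 < t * real N" "t * real N \<le> real j" "0 < t * real N"
      using assms unfolding j_def by (auto, linarith+)
    have "t * real N < real N" using \<open>t < 1\<close> assms by simp
    then have "real j < real N + 1" using j by linarith
    then have "j \<in> {1..N}" using j by auto
    moreover from this have "t \<noteq> real j / real N" using t by auto
    ultimately show "\<exists>j\<in>{1..N}. (real j - 1) / real N < t \<and> t < real j / real N"
      using j assms by (intro bexI[of _ j]) (auto simp: field_simps)
  qed
qed auto

text \<open>Inside the unit interval the mass from a cut up to a point is their distance, so the
  defining equation of \<open>F i\<close> forces a translation from cell \<open>j\<close> to cell
  \<open>k\<close>.\<close>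

lemma cyclic_maps_uniform01_eq:
  assumes "2 \<le> N" and F: "cyclic_maps (uniform_measure lborel {0..1}) N F"
  shows "AE t in uniform_measure lborel {0..1}. \<forall>i\<in>{1..N}. \<forall>j\<in>{1..N}. \<forall>k\<in>{1..N}.
    k mod N = (i + j - 1) mod N \<longrightarrow> (real j - 1) / real N < t \<longrightarrow> t < real j / real N \<longrightarrow>
    F i t = t + (real k - real j) / real N"
proof (intro AE_finite_allI finite_atLeastAtMost)
  let ?U = "uniform_measure lborel {0..1::real}"
  fix i j k assume ijk: "i \<in> {1..N}" "j \<in> {1..N}" "k \<in> {1..N}"
  show "AE t in ?U. k mod N = (i + j - 1) mod N \<longrightarrow> (real j - 1) / real N < t \<longrightarrow>
    t < real j / real N \<longrightarrow> F i t = t + (real k - real j) / real N"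
  proof (cases "k mod N = (i + j - 1) mod N")
    case True
    with F ijk have "AE t in ?U. t \<in> cell ?U N j \<longrightarrow>
        F i t \<in> cell ?U N k \<and>
        measure ?U {s. cut_point ?U N (k - 1) < ereal s \<and> s < F i t} =
        measure ?U {s. cut_point ?U N (j - 1) < ereal s \<and> s < t}"
      unfolding cyclic_maps_def by blast
    then show ?thesis
    proof (rule eventually_mono, intro impI)
      fix t assume t: "(real j - 1) / real N < t" "t < real j / real N"
        and *: "t \<in> cell ?U N j \<longrightarrow> F i t \<in> cell ?U N k \<and>
        measure ?U {s. cut_point ?U N (k - 1) < ereal s \<and> s < F i t} =
        measure ?U {s. cut_point ?U N (j - 1) < ereal s \<and> s < t}"
      let ?a = "(real k - 1) / real N"
      have "t \<in> cell ?U N j" using t ijk by (simp add: cell_uniform01)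
      with * t ijk have "measure ?U {s. cut_point ?U N (k - 1) < ereal s \<and> s < F i t} =
          t - (real j - 1) / real N"
        using measure_cut_uniform01[of j N t] by simp
      \<comment> \<open>For \<open>k = 1\<close> the cut is minus infinity, but the mass only starts
        at \<open>?a = 0\<close>, so the same formula holds.\<close>
      moreover have "measure ?U {s. cut_point ?U N (k - 1) < ereal s \<and> s < F i t} =
          max 0 (min (F i t) 1 - ?a)"
      proof (cases "k = 1")
        case True
        then show ?thesis by (simp add: measure_uniform01_less del: measure_uniform_measure)
      next
        case False
        then have "cut_point ?U N (k - 1) = ereal ?a"
          using ijk cut_uniform01[of "k - 1" N] by (auto simp: of_nat_diff)
        moreover have "0 \<le> ?a" "?a \<le> 1" using ijk by auto
        ultimately show ?thesis by (simp add: measure_uniform01_Ioo del: measure_uniform_measure)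
      qed
      \<comment> \<open>The common mass is positive, which excludes the clamp at 0, and below
        \<open>1 / N\<close>, hence below \<open>1 - ?a\<close>, which excludes the clamp at
        1.\<close>
      moreover have "t - (real j - 1) / real N < 1 / real N" "?a + 1 / real N \<le> 1"
        using t ijk by (auto simp: diff_divide_distrib)
      ultimately have "F i t - ?a = t - (real j - 1) / real N" using t by linarith
      then show "F i t = t + (real k - real j) / real N" by (simp add: diff_divide_distrib)
    qed
  qed simp
qed

section \<open>Rotations modulo 1 and the marginals of the plan\<close>

lemma distr_rotation_uniform01:
  fixes a :: real
  assumes a: "0 \<le> a" "a \<le> 1"
  shows "distr (uniform_measure lborel {0..1}) borel (\<lambda>t. if t < 1 - a then t + a else t + a - 1) =
    uniform_measure lborel {0..1}" (is "distr ?U borel ?r = ?U")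
proof (rule measure_eqI)
  fix A assume "A \<in> sets (distr ?U borel ?r)"
  then have [measurable]: "A \<in> sets borel" by simp
  have shift: "emeasure lborel {t. t + c \<in> B} = emeasure lborel B"
    if [measurable]: "B \<in> sets borel" for B and c :: real
  proof -
    have "emeasure lborel B = emeasure (distr lborel borel ((+) c)) B"
      by (simp add: lborel_distr_plus)
    also have "\<dots> = emeasure lborel {t. t + c \<in> B}"
      by (subst emeasure_distr) (auto simp: add.commute intro!: arg_cong[where f = "emeasure lborel"])
    finally show ?thesis by simp
  qed
  have "emeasure (distr ?U borel ?r) A = emeasure ?U {t. ?r t \<in> A}"
    by (subst emeasure_distr) (auto simp: vimage_def)
  also have "\<dots> = emeasure lborel ({0..1} \<inter> {t. ?r t \<in> A})"
    by (subst emeasure_uniform_measure) (auto simp: divide_ennreal_def)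
  \<comment> \<open>The rotation is split at its jump into two translations, to which invariance of
    Lebesgue measure applies.\<close>
  also have "{0..1} \<inter> {t. ?r t \<in> A} =
      {t. t + a \<in> A \<inter> {a..<1}} \<union> {t. t + (a - 1) \<in> A \<inter> {0..a}}"
    using a by (auto simp: add_diff_eq split: if_splits)
  also have "emeasure lborel \<dots> =
      emeasure lborel {t. t + a \<in> A \<inter> {a..<1}} + emeasure lborel {t. t + (a - 1) \<in> A \<inter> {0..a}}"
    by (rule plus_emeasure[symmetric]) auto
  also have "\<dots> = emeasure lborel (A \<inter> {a..<1}) + emeasure lborel (A \<inter> {0..a})"
    by (simp only: shift sets.Int \<open>A \<in> sets borel\<close> atLeastLessThan_borel atLeastAtMost_borel)
  \<comment> \<open>Swapping endpoints, a null change, makes this piece disjoint from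
    \<open>{0..a}\<close> with union \<open>{0..1}\<close>.\<close>
  also have "emeasure lborel (A \<inter> {a..<1}) = emeasure lborel (A \<inter> {a<..1})"
    using AE_lborel_singleton[of a] AE_lborel_singleton[of 1]
    by (intro emeasure_eq_AE) (auto elim!: eventually_elim2)
  also have "\<dots> + emeasure lborel (A \<inter> {0..a}) = emeasure lborel ({0..1} \<inter> A)"
    using a by (subst plus_emeasure) (auto intro!: arg_cong[where f = "emeasure lborel"])
  also have "\<dots> = emeasure ?U A"
    by (subst emeasure_uniform_measure) (auto simp: divide_ennreal_def)
  finally show "emeasure (distr ?U borel ?r) A = emeasure ?U A" .
qed simp


lemma cyclic_maps_measurable:
  assumes "cyclic_maps \<rho> N F" "i \<in> {1..N}"
  shows "F i \<in> borel_measurable (uniform_measure lborel A)"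
proof -
  have "F i \<in> borel_measurable borel"
    using assms unfolding cyclic_maps_def by blast
  then show ?thesis by simp
qed

text \<open>Almost everywhere \<open>F i\<close> is the rotation by \<open>(i - 1) / N\<close>
  modulo 1, which preserves the uniform measure.\<close>

lemma map_plan_uniform01_in_transport_plans:
  assumes "2 \<le> N" and F: "cyclic_maps (uniform_measure lborel {0..1}) N F"
  shows "map_plan N (uniform_measure lborel {0..1}) F \<in>
    transport_plans N (uniform_measure lborel {0..1})"
proof -
  let ?U = "uniform_measure lborel {0..1::real}"
  note meas = cyclic_maps_measurable[OF F]
  have T[measurable]: "(\<lambda>t. \<lambda>i\<in>{1..N}. F i t) \<in> ?U \<rightarrow>\<^sub>M Pi\<^sub>M {1..N} (\<lambda>_. borel)"
    by (intro measurable_restrict meas)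
  have N: "0 < N" using assms by simp
  interpret prob_space ?U by (rule prob_space_uniform_measure) auto
  have "distr (map_plan N ?U F) borel (\<lambda>x. x i) = ?U" if i: "i \<in> {1..N}" for i
  proof -
    let ?a = "(real i - 1) / real N"
    have a: "0 \<le> ?a" "?a \<le> 1" using i by auto
    have "distr (map_plan N ?U F) borel (\<lambda>x. x i) = distr ?U borel (F i)"
      unfolding map_plan_def using i distr_distr[OF measurable_component_singleton[OF i] T] by (simp add: comp_def)
    also have "\<dots> = distr ?U borel (\<lambda>t. if t < 1 - ?a then t + ?a else t + ?a - 1)"
    proof (rule distr_cong_AE)
      show "AE t in ?U. F i t = (if t < 1 - ?a then t + ?a else t + ?a - 1)"
        using cyclic_maps_uniform01_eq[OF assms] AE_uniform01_cell[OF N]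
      proof eventually_elim
        case (elim t)
        then obtain j where j: "j \<in> {1..N}" "(real j - 1) / real N < t" "t < real j / real N"
          by auto
        have shift: "F i t = t + (real k - real j) / real N"
          if "k \<in> {1..N}" "k mod N = (i + j - 1) mod N" for k
          using elim(1) i j that by blast
        show ?case
        \<comment> \<open>The condition says that cell \<open>j\<close> lies to the left of the jump
          at \<open>1 - ?a\<close>; otherwise the whole cell lies to its right and the index wraps
          around.\<close>
        proof (cases "i + j - 1 \<le> N")
          case True
          then have "F i t = t + (real (i + j - 1) - real j) / real N"
            using i j by (intro shift) auto
          moreover have "real j / real N + ?a \<le> 1"
            using True i assms by (simp add: add_divide_distrib[symmetric])
          ultimately show ?thesis using j i by (simp add: of_nat_diff)
        next
          case False
          then have "F i t = t + (real (i + j - 1 - N) - real j) / real N"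
            using False i j by (intro shift) (auto simp: le_mod_geq)
          also have "\<dots> = t + ?a - 1"
            using False i j by (simp add: of_nat_diff field_simps)
          finally have "F i t = t + ?a - 1" .
          moreover have "1 \<le> (real j - 1) / real N + ?a"
            using False i assms by (simp add: add_divide_distrib[symmetric])
          ultimately show ?thesis using j by simp
        qed
      qed
    qed (use meas i in auto)
    also have "\<dots> = ?U" using a by (rule distr_rotation_uniform01)
    finally show ?thesis .
  qed
  moreover have "prob_space (map_plan N ?U F)"
    unfolding map_plan_def by (rule prob_space_distr) measurable
  ultimately show ?thesis
    by (auto simp: transport_plans_def map_plan_def)
qed

section \<open>The cost of the cyclic plan\<close>

lemma coulomb_cost_map_plan_uniform01:
  assumes "2 \<le> N" and F: "cyclic_maps (uniform_measure lborel {0..1}) N F"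
  shows "coulomb_cost N (map_plan N (uniform_measure lborel {0..1}) F) =
    2 * ennreal (\<Sum>k\<in>{1..<N}. (real N - real k) * (real N / real k))"
proof -
  let ?U = "uniform_measure lborel {0..1::real}"
  let ?T = "\<lambda>t. \<lambda>i\<in>{1..N}. F i t"
  let ?S = "\<lambda>x :: nat \<Rightarrow> real. \<Sum>(i, j) \<in> {(i, j). i \<in> {1..N} \<and> j \<in> {1..N} \<and> i \<noteq> j}.
      1 / ennreal (norm (x i - x j))"
  let ?c = "2 * ennreal (\<Sum>k\<in>{1..<N}. (real N - real k) * (real N / real k))"
  have T[measurable]: "?T \<in> ?U \<rightarrow>\<^sub>M Pi\<^sub>M {1..N} (\<lambda>_. borel)"
    by (intro measurable_restrict cyclic_maps_measurable[OF F])
  have N: "0 < N" using assms by simp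
  interpret prob_space ?U by (rule prob_space_uniform_measure) auto
  have "?S \<in> borel_measurable (Pi\<^sub>M {1..N} (\<lambda>_. borel))"
    by (intro borel_measurable_sum) (auto simp: case_prod_beta)
  then have "coulomb_cost N (map_plan N ?U F) = (\<integral>\<^sup>+t. ?S (?T t) \<partial>?U)"
    unfolding coulomb_cost_def map_plan_def by (simp only: nn_integral_distr[OF T] measurable_distr_eq1)
  also have "\<dots> = (\<integral>\<^sup>+t. ?c \<partial>?U)"
  proof (rule nn_integral_cong_AE)
    show "AE t in ?U. ?S (?T t) = ?c"
      using cyclic_maps_uniform01_eq[OF assms] AE_uniform01_cell[OF N]
    proof eventually_elim
      case (elim t)
      then obtain j where j: "j \<in> {1..N}" "(real j - 1) / real N < t" "t < real j / real N"
        using assms by auto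
      \<comment> \<open>\<open>\<sigma> p\<close> is the index \<open>i\<close> for which
        \<open>F i\<close> sends cell \<open>j\<close> to cell \<open>p\<close>, that is, the
        solution in \<open>{1..N}\<close> of \<open>p = i + j - 1\<close> modulo \<open>N\<close>.
        It lists the tuple in increasing order with spacing \<open>1 / N\<close>.\<close>
      define \<sigma> where "\<sigma> p = (if j \<le> p then p - j + 1 else p + N - j + 1)" for p
      have \<sigma>: "bij_betw \<sigma> {1..N} {1..N}"
        by (rule bij_betw_byWitness[where f' = "\<lambda>i. if i + j - 1 \<le> N then i + j - 1 else i + j - 1 - N"])
          (use j in \<open>auto simp: \<sigma>_def\<close>)
      have eq: "?T t (\<sigma> p) = t + (real p - real j) / real N" if "p \<in> {1..N}" for p
      proof -
        have "\<sigma> p \<in> {1..N}" using that \<sigma> by (rule bij_betwE[THEN bspec, rotated])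
        moreover have "\<sigma> p + j - 1 = p \<or> \<sigma> p + j - 1 = p + N"
          using j by (auto simp: \<sigma>_def)
        then have "p mod N = (\<sigma> p + j - 1) mod N" by auto
        ultimately show ?thesis using elim j that by auto
      qed
      have "?S (?T t) = 2 * (\<Sum>k\<in>{1..<N}. \<Sum>p\<in>{1..N - k}. 1 / ennreal (?T t (\<sigma> (p + k)) - ?T t (\<sigma> p)))"
        using \<sigma> by (rule coulomb_sum_sorted) (subst eq, force, subst eq, force, simp add: divide_right_mono)
      also have "\<dots> = 2 * (\<Sum>k\<in>{1..<N}. \<Sum>p\<in>{1..N - k}. ennreal (real N / real k))"
      proof (intro arg_cong[where f = "(*) 2"] sum.cong refl)
        fix k p assume kp: "k \<in> {1..<N}" "p \<in> {1..N - k}"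
        then have "?T t (\<sigma> (p + k)) - ?T t (\<sigma> p) = real k / real N"
          by (subst eq, force)+ (simp add: diff_divide_distrib add_divide_distrib)
        then show "1 / ennreal (?T t (\<sigma> (p + k)) - ?T t (\<sigma> p)) = ennreal (real N / real k)"
          using kp by (simp add: divide_ennreal[of 1, simplified])
      qed
      also have "\<dots> = 2 * (\<Sum>k\<in>{1..<N}. ennreal ((real N - real k) * (real N / real k)))"
        by (intro arg_cong[where f = "(*) 2"] sum.cong refl)
          (simp add: ennreal_mult'[symmetric] of_nat_diff ennreal_of_nat_eq_real_of_nat)
      also have "\<dots> = ?c" by (subst sum_ennreal) auto
      finally show ?case .
    qed
  qed
  also have "\<dots> = ?c" by (simp add: emeasure_space_1)
  finally show ?thesis .
qed

theorem theorem2p1p2: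
  fixes N :: nat and \<rho> :: "real measure" and F :: "nat \<Rightarrow> real \<Rightarrow> real"
  assumes "N \<ge> 2"
    and "\<rho> = uniform_measure lborel {0..1}"
    and "cyclic_maps \<rho> N F"
  shows "map_plan N \<rho> F \<in> transport_plans N \<rho> \<and>
         coulomb_cost N (map_plan N \<rho> F) = optimal_cost N \<rho>"
proof
  show plan: "map_plan N \<rho> F \<in> transport_plans N \<rho>"
    using assms map_plan_uniform01_in_transport_plans by simp
  show "coulomb_cost N (map_plan N \<rho> F) = optimal_cost N \<rho>"
    unfolding optimal_cost_def
  proof (rule antisym)
    \<comment> \<open>The cost of the plan is exactly the constant that bounds every transport plan
      from below.\<close>
    show "coulomb_cost N (map_plan N \<rho> F) \<le> (INF M\<in>transport_plans N \<rho>. coulomb_cost N M)"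
      using assms by (intro INF_greatest)
        (simp only: coulomb_cost_map_plan_uniform01 coulomb_cost_ge_uniform01)
    show "(INF M\<in>transport_plans N \<rho>. coulomb_cost N M) \<le> coulomb_cost N (map_plan N \<rho> F)"
      using plan by (rule INF_lower)
  qed
qed

end
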